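(* Let $g,h\in C^4[c,d]$ be the lower and upper boundary functions of a hole over $[c,d]\subset(a,b)$, and let $\phi=h-g$. If $\phi'(c)=C>0$, then the approximation $(\tilde c,\tilde g_L(\tilde c))$ of the left point of change of topology $(c,g(c))$, defined in the context from samples at $x_i=a+i\Delta$, $\Delta=(b-a)/N$, satisfies $$E=\sqrt{|c-\tilde c|^2+|g(c)-\tilde g_L(\tilde c)|^2}=O(\Delta^4)\quad\text{as }\Delta\to0 .$$
   Context: The hole is $\{(x,y): g(x)<y<h(x),\ x\in(c,d)\}$ with $a<c<d<b$, $g(c)=h(c)$, $g(d)=h(d)$ and $g<h$ on $(c,d)$; its left point of change of topology (PCT) is $(c,g(c))$. Let $x_n,\dots,x_m$ be all the points $x_i=a+i\Delta$ ($0\le i\le N$) lying in $(c,d)$ (with $m-n\ge3$ for small $\Delta$). Let $\tilde g_L,\tilde h_L$ be the cubic polynomials interpolating $g$, respectively $h$, at $x_n,x_{n+1},x_{n+2},x_{n+3}$. Then $\tilde c$ is the abscissa of the intersection point of the graphs of $\tilde g_L$ and $\tilde h_L$ near $x_n$ (the root of $\tilde h_L-\tilde g_L$ closest to $x_n$); if this abscissa is $<x_n-\Delta$, one takes $\tilde c=x_n-\Delta$ instead. *)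

theory Defs
  imports
    "HOL-Analysis.Analysis"
    "HOL-Computational_Algebra.Polynomial"
    "HOL-Library.Landau_Symbols"
begin

(* On S = {c..d} the derivatives at the endpoints are one-sided. *)
definition Ck_on :: "nat \<Rightarrow> (real \<Rightarrow> real) \<Rightarrow> real set \<Rightarrow> bool" where
  "Ck_on k f S \<longleftrightarrow> (\<exists>D :: nat \<Rightarrow> real \<Rightarrow> real.
     (\<forall>x\<in>S. D 0 x = f x) \<and>
     (\<forall>j<k. \<forall>x\<in>S. (D j has_real_derivative D (Suc j) x) (at x within S)) \<and>
     continuous_on S (D k))"

(* The hole itself is the region {(x, y). c < x < d, g x < y < h x}. *)
definition hole_boundaries ::
    "real \<Rightarrow> real \<Rightarrow> real \<Rightarrow> real \<Rightarrow> (real \<Rightarrow> real) \<Rightarrow> (real \<Rightarrow> real) \<Rightarrow> bool" where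
  "hole_boundaries a b c d g h \<longleftrightarrow>
     a < c \<and> c < d \<and> d < b \<and> g c = h c \<and> g d = h d \<and> (\<forall>x\<in>{c<..<d}. g x < h x)"

definition step :: "real \<Rightarrow> real \<Rightarrow> nat \<Rightarrow> real" where
  "step a b N = (b - a) / real N"

definition grid :: "real \<Rightarrow> real \<Rightarrow> nat \<Rightarrow> nat \<Rightarrow> real" where
  "grid a b N i = a + real i * step a b N"

definition first_index :: "real \<Rightarrow> real \<Rightarrow> real \<Rightarrow> real \<Rightarrow> nat \<Rightarrow> nat" where
  "first_index a b c d N = (LEAST i. i \<le> N \<and> grid a b N i \<in> {c<..<d})"

(* "Cubic" means of degree at most 3.  Meaningful once x_n, ..., x_(n+3) all lie in (c, d),
   which holds for all sufficiently large N. *)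
definition left_cubic ::
    "real \<Rightarrow> real \<Rightarrow> real \<Rightarrow> real \<Rightarrow> (real \<Rightarrow> real) \<Rightarrow> nat \<Rightarrow> real poly" where
  "left_cubic a b c d f N =
     (let n = first_index a b c d N in
      THE p. degree p \<le> 3 \<and>
             (\<forall>i\<in>{n..n+3}. poly p (grid a b N i) = f (grid a b N i)))"

(* An arbitrary real number if the two cubics do not intersect; if two intersection points
   are equally close to x_n, an arbitrary one of them.  Neither happens for large N when
   the one-sided derivative of h - g at c is positive. *)
definition left_root ::
    "real \<Rightarrow> real \<Rightarrow> real \<Rightarrow> real \<Rightarrow> (real \<Rightarrow> real) \<Rightarrow> (real \<Rightarrow> real) \<Rightarrow> nat \<Rightarrow> real" where
  "left_root a b c d g h N =
     (ARG_MIN (\<lambda>t. \<bar>t - grid a b N (first_index a b c d N)\<bar>) t.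
        poly (left_cubic a b c d h N - left_cubic a b c d g N) t = 0)"

definition left_pct_abscissa ::
    "real \<Rightarrow> real \<Rightarrow> real \<Rightarrow> real \<Rightarrow> (real \<Rightarrow> real) \<Rightarrow> (real \<Rightarrow> real) \<Rightarrow> nat \<Rightarrow> real" where
  "left_pct_abscissa a b c d g h N =
     (let x = grid a b N (first_index a b c d N);
          r = left_root a b c d g h N
      in if r < x - step a b N then x - step a b N else r)"

definition left_pct_error ::
    "real \<Rightarrow> real \<Rightarrow> real \<Rightarrow> real \<Rightarrow> (real \<Rightarrow> real) \<Rightarrow> (real \<Rightarrow> real) \<Rightarrow> nat \<Rightarrow> real" where
  "left_pct_error a b c d g h N =
     (let ct = left_pct_abscissa a b c d g h N
      in sqrt (\<bar>c - ct\<bar>\<^sup>2 + \<bar>g c - poly (left_cubic a b c d g N) ct\<bar>\<^sup>2))"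

end

theory Submission
  imports Defs
begin

text \<open>
  Split each boundary function \<open>f\<close> as its cubic Taylor polynomial at \<open>c\<close> plus a remainder of size
  \<open>O((x - c)^4)\<close>.  Interpolation reproduces the Taylor polynomial and, the nodes being equally
  spaced, turns nodal values of the remainder of size \<open>O(\<Delta>^4)\<close> into a cubic that is
  \<open>O(\<Delta>^4)\<close>, with Lipschitz constant \<open>O(\<Delta>^3)\<close>, on an interval of length
  \<open>O(\<Delta>)\<close> around the nodes.  So on that interval the interpolant of \<open>\<phi> = h - g\<close> has
  slope at least \<open>C / 2\<close> and takes at \<open>c\<close> a value \<open>O(\<Delta>^4)\<close>, which puts its only root there
  within \<open>O(\<Delta>^4)\<close> of \<open>c\<close>.
\<close>

section \<open>Lagrange interpolation at equispaced nodes\<close>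

text \<open>The nodes are the integers \<open>0, ..., n\<close>, so the basis does not depend on the
  step. A grid \<open>x + i * \<Delta>\<close> is reached from it by an affine substitution, which
  is what later makes the constants uniform in \<Delta>.\<close>

definition lagrange_basis :: "nat \<Rightarrow> nat \<Rightarrow> real poly" where
  "lagrange_basis n i = (\<Prod>j\<in>{..n}-{i}. smult (inverse (real i - real j)) [:- real j, 1:])"

lemma degree_lagrange_basis:
  assumes "i \<le> n"
  shows "degree (lagrange_basis n i) \<le> n"
proof -
  have "degree (lagrange_basis n i)
      \<le> sum (degree \<circ> (\<lambda>j. smult (inverse (real i - real j)) [:- real j, 1:])) ({..n}-{i})"
    unfolding lagrange_basis_def by (rule degree_prod_sum_le) simp
  also have "\<dots> \<le> (\<Sum>j\<in>{..n}-{i}. 1)"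
    by (rule sum_mono) simp
  also have "\<dots> = n"
    using assms by simp
  finally show ?thesis .
qed

lemma poly_lagrange_basis:
  assumes "i \<le> n" "j \<le> n"
  shows "poly (lagrange_basis n i) (real j) = (if i = j then 1 else 0)"
proof (cases "i = j")
  case True
  have "inverse (real i - real k) * (real i - real k) = 1" if "k \<noteq> i" for k
    using that by simp
  with True show ?thesis
    unfolding lagrange_basis_def poly_prod
    by (auto intro!: prod.neutral simp: right_diff_distrib[symmetric] mult.commute[of _ "inverse _"])
next
  case False
  with assms show ?thesis
    unfolding lagrange_basis_def poly_prod by (auto intro!: bexI[of _ j])
qed

lemma poly_eqI_nodes:
  fixes p q :: "real poly"
  assumes "degree p \<le> n" "degree q \<le> n" "\<Delta> \<noteq> 0"
    and "\<And>i. i \<le> n \<Longrightarrow> poly p (x + real i * \<Delta>) = poly q (x + real i * \<Delta>)"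
  shows "p = q"
proof (rule poly_eqI_degree)
  have "card ((\<lambda>i. x + real i * \<Delta>) ` {..n}) = Suc n"
    using assms(3) by (subst card_image) (auto intro: inj_onI)
  then show "card ((\<lambda>i. x + real i * \<Delta>) ` {..n}) > degree p"
    "card ((\<lambda>i. x + real i * \<Delta>) ` {..n}) > degree q"
    using assms(1,2) by auto
qed (use assms(4) in auto)

lemma lagrange_expansion:
  fixes y :: "nat \<Rightarrow> real" and n :: nat
  defines "P \<equiv> \<Sum>i\<le>n. smult (y i) (lagrange_basis n i)"
  shows "degree P \<le> n" and "\<And>j. j \<le> n \<Longrightarrow> poly P (real j) = y j"
proof -
  show "degree P \<le> n"
    unfolding P_def
    by (rule degree_sum_le) (auto intro: order_trans[OF degree_smult_le] degree_lagrange_basis)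
  show "poly P (real j) = y j" if "j \<le> n" for j
  proof -
    have "poly P (real j) = (\<Sum>i\<le>n. if i = j then y i else 0)"
      unfolding P_def poly_sum poly_smult using that by (intro sum.cong) (auto simp: poly_lagrange_basis)
    also have "\<dots> = y j"
      using that by simp
    finally show ?thesis .
  qed
qed

lemma degree_pcompose_linear:
  fixes p :: "real poly"
  shows "degree (pcompose p [:u, v:]) \<le> degree p"
  by (cases "v = 0") (simp_all add: degree_pcompose)

text \<open>Composing the interpolant at the integers with
  \<open>t \<mapsto> (t - x) / \<Delta>\<close> carries node \<open>x + i * \<Delta>\<close> to
  \<open>i\<close> and does not raise the degree.\<close>

lemma interpolating_poly_exists:
  fixes y :: "nat \<Rightarrow> real"
  assumes "\<Delta> \<noteq> 0"
  obtains p where "degree p \<le> n" "\<And>i. i \<le> n \<Longrightarrow> poly p (x + real i * \<Delta>) = y i"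
proof
  let ?P = "\<Sum>i\<le>n. smult (y i) (lagrange_basis n i)"
  let ?p = "pcompose ?P [:- x / \<Delta>, 1 / \<Delta>:]"
  show "degree ?p \<le> n"
    using degree_pcompose_linear lagrange_expansion(1) by (rule order_trans)
  show "poly ?p (x + real i * \<Delta>) = y i" if "i \<le> n" for i
  proof -
    have "- x / \<Delta> + (x + real i * \<Delta>) / \<Delta> = real i"
      using assms by (simp add: field_simps)
    then show ?thesis
      using lagrange_expansion(2)[OF that, of y] by (simp add: poly_pcompose)
  qed
qed

section \<open>Stability of interpolation on a window proportional to the step\<close>

text \<open>A polynomial and its derivative are bounded on a compact interval, and a bound on the
  derivative is a Lipschitz constant. One \<open>B\<close> serves both purposes.\<close>

lemma poly_bounded_lipschitz_on_Icc:
  fixes p :: "real poly"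
  obtains B where "B \<ge> 0" "\<And>s. s \<in> {u..v} \<Longrightarrow> \<bar>poly p s\<bar> \<le> B"
    "\<And>s t. s \<in> {u..v} \<Longrightarrow> t \<in> {u..v} \<Longrightarrow> \<bar>poly p s - poly p t\<bar> \<le> B * \<bar>s - t\<bar>"
proof -
  have "\<exists>B. \<forall>s\<in>{u..v}. \<bar>poly q s\<bar> \<le> B" for q :: "real poly"
  proof -
    have "compact (poly q ` {u..v})"
      by (intro compact_continuous_image continuous_intros compact_Icc)
    then show ?thesis
      by (metis bounded_iff compact_imp_bounded imageI real_norm_def)
  qed
  then obtain B B' where B: "\<And>s. s \<in> {u..v} \<Longrightarrow> \<bar>poly p s\<bar> \<le> B"
    and B': "\<And>s. s \<in> {u..v} \<Longrightarrow> \<bar>poly (pderiv p) s\<bar> \<le> B'"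
    by metis
  show ?thesis
  proof
    \<comment> \<open>The absolute values secure nonnegativity also when \<open>{u..v}\<close> is
      empty and \<open>B\<close>, \<open>B'\<close> are unconstrained.\<close>
    show "\<bar>B\<bar> + \<bar>B'\<bar> \<ge> 0" by simp
    show "\<bar>poly p s\<bar> \<le> \<bar>B\<bar> + \<bar>B'\<bar>" if "s \<in> {u..v}" for s
      using B[OF that] by linarith
    show "\<bar>poly p s - poly p t\<bar> \<le> (\<bar>B\<bar> + \<bar>B'\<bar>) * \<bar>s - t\<bar>" if "s \<in> {u..v}" "t \<in> {u..v}" for s t
    proof -
      have "norm (poly p s - poly p t) \<le> (\<bar>B\<bar> + \<bar>B'\<bar>) * norm (s - t)"
      proof (rule field_differentiable_bound[where S="{u..v}" and f'="poly (pderiv p)"])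
        show "norm (poly (pderiv p) z) \<le> \<bar>B\<bar> + \<bar>B'\<bar>" if "z \<in> {u..v}" for z
          using B'[OF that] by simp
      qed (use that in \<open>auto intro: has_field_derivative_at_within\<close>)
      then show ?thesis by simp
    qed
  qed
qed

text \<open>In the variable \<open>(s - x) / \<Delta>\<close> the nodes become integers and the
  window becomes \<open>{-r..r}\<close>, so sup and Lipschitz bounds of the fixed Lagrange basis
  apply. Hence \<open>K\<close> depends on \<open>n\<close> and \<open>r\<close> alone; undoing the
  scaling costs the Lipschitz estimate a factor \<open>1 / \<Delta>\<close>.\<close>

lemma equispaced_interpolation_stable:
  fixes r :: real
  obtains K where "K \<ge> 0"
    "\<And>(q :: real poly) x \<Delta> M s. \<lbrakk>degree q \<le> n; \<Delta> > 0; \<And>i. i \<le> n \<Longrightarrow> \<bar>poly q (x + real i * \<Delta>)\<bar> \<le> M;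
       \<bar>s - x\<bar> \<le> r * \<Delta>\<rbrakk> \<Longrightarrow> \<bar>poly q s\<bar> \<le> K * M"
    "\<And>(q :: real poly) x \<Delta> M s t. \<lbrakk>degree q \<le> n; \<Delta> > 0; \<And>i. i \<le> n \<Longrightarrow> \<bar>poly q (x + real i * \<Delta>)\<bar> \<le> M;
       \<bar>s - x\<bar> \<le> r * \<Delta>; \<bar>t - x\<bar> \<le> r * \<Delta>\<rbrakk> \<Longrightarrow> \<bar>poly q s - poly q t\<bar> \<le> K * M / \<Delta> * \<bar>s - t\<bar>"
proof -
  have "\<exists>B\<ge>0. (\<forall>s\<in>{-r..r}. \<bar>poly (lagrange_basis n i) s\<bar> \<le> B) \<and>
      (\<forall>s\<in>{-r..r}. \<forall>t\<in>{-r..r}. \<bar>poly (lagrange_basis n i) s - poly (lagrange_basis n i) t\<bar> \<le> B * \<bar>s - t\<bar>)"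
    for i
    using poly_bounded_lipschitz_on_Icc[of "-r" r "lagrange_basis n i"] by metis
  then obtain B where B0: "\<And>i. B i \<ge> 0"
    and B1: "\<And>i s. s \<in> {-r..r} \<Longrightarrow> \<bar>poly (lagrange_basis n i) s\<bar> \<le> B i"
    and B2: "\<And>i s t. s \<in> {-r..r} \<Longrightarrow> t \<in> {-r..r} \<Longrightarrow>
      \<bar>poly (lagrange_basis n i) s - poly (lagrange_basis n i) t\<bar> \<le> B i * \<bar>s - t\<bar>"
    by metis
  define K where "K = (\<Sum>i\<le>n. B i)"
  \<comment> \<open>The rescaled polynomial \<open>q (x + \<Delta> * t)\<close> has degree at most
    \<open>n\<close>, so it equals its own Lagrange interpolant at the integers.\<close>
  have expand: "poly q s = (\<Sum>i\<le>n. poly q (x + real i * \<Delta>) * poly (lagrange_basis n i) ((s - x) / \<Delta>))"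
    if "degree q \<le> n" "\<Delta> > 0" for q x \<Delta> s
  proof -
    let ?P = "\<Sum>i\<le>n. smult (poly q (x + real i * \<Delta>)) (lagrange_basis n i)"
    have "pcompose q [:x, \<Delta>:] = ?P"
    proof (rule poly_eqI_nodes[where \<Delta>=1 and x=0 and n=n])
      show "poly (pcompose q [:x, \<Delta>:]) (0 + real i * 1) = poly ?P (0 + real i * 1)" if "i \<le> n" for i
        using lagrange_expansion(2)[OF that, of "\<lambda>i. poly q (x + real i * \<Delta>)"]
        by (simp add: poly_pcompose)
    qed (use that degree_pcompose_linear[of q] lagrange_expansion(1) in \<open>auto intro: order_trans\<close>)
    then have "poly (pcompose q [:x, \<Delta>:]) ((s - x) / \<Delta>) = poly ?P ((s - x) / \<Delta>)"
      by simp
    moreover have "x + (s - x) / \<Delta> * \<Delta> = s"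
      using that by simp
    ultimately show ?thesis
      by (simp add: poly_pcompose poly_sum)
  qed
  have scaled: "(s - x) / \<Delta> \<in> {-r..r}" if "\<Delta> > 0" "\<bar>s - x\<bar> \<le> r * \<Delta>" for s x \<Delta>
    using that by (auto simp: field_simps abs_le_iff)
  show ?thesis
  proof
    show "K \<ge> 0"
      unfolding K_def by (intro sum_nonneg B0)
  next
    fix q :: "real poly" and x \<Delta> M s
    assume q: "degree q \<le> n" "\<Delta> > 0" "\<And>i. i \<le> n \<Longrightarrow> \<bar>poly q (x + real i * \<Delta>)\<bar> \<le> M"
      and s: "\<bar>s - x\<bar> \<le> r * \<Delta>"
    have "\<bar>poly q s\<bar> \<le> (\<Sum>i\<le>n. \<bar>poly q (x + real i * \<Delta>) * poly (lagrange_basis n i) ((s - x) / \<Delta>)\<bar>)"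
      unfolding expand[OF q(1,2), of s x] by (rule sum_abs)
    also have "\<dots> \<le> (\<Sum>i\<le>n. M * B i)"
      unfolding abs_mult using q(3) B1[OF scaled[OF q(2) s]] by (intro sum_mono mult_mono') auto
    finally show "\<bar>poly q s\<bar> \<le> K * M"
      by (simp add: K_def sum_distrib_left mult.commute)
  next
    fix q :: "real poly" and x \<Delta> M s t
    assume q: "degree q \<le> n" "\<Delta> > 0" "\<And>i. i \<le> n \<Longrightarrow> \<bar>poly q (x + real i * \<Delta>)\<bar> \<le> M"
      and s: "\<bar>s - x\<bar> \<le> r * \<Delta>" and t: "\<bar>t - x\<bar> \<le> r * \<Delta>"
    let ?L = "\<lambda>i s. poly (lagrange_basis n i) ((s - x) / \<Delta>)"
    have "\<bar>(s - x) / \<Delta> - (t - x) / \<Delta>\<bar> = \<bar>s - t\<bar> / \<Delta>"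
      using q(2) by (simp add: diff_divide_distrib[symmetric])
    then have L: "\<bar>?L i s - ?L i t\<bar> \<le> B i * (\<bar>s - t\<bar> / \<Delta>)" for i
      using B2[OF scaled[OF q(2) s] scaled[OF q(2) t], of i] by simp
    have "poly q s - poly q t = (\<Sum>i\<le>n. poly q (x + real i * \<Delta>) * (?L i s - ?L i t))"
      unfolding expand[OF q(1,2), of s x] expand[OF q(1,2), of t x]
      by (simp only: sum_subtractf right_diff_distrib)
    then have "\<bar>poly q s - poly q t\<bar> \<le> (\<Sum>i\<le>n. \<bar>poly q (x + real i * \<Delta>) * (?L i s - ?L i t)\<bar>)"
      by (simp only: sum_abs)
    also have "\<dots> \<le> (\<Sum>i\<le>n. M * (B i * (\<bar>s - t\<bar> / \<Delta>)))"
      unfolding abs_mult using q(3) L by (intro sum_mono mult_mono') auto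
    also have "\<dots> = K * M / \<Delta> * \<bar>s - t\<bar>"
      unfolding K_def sum_distrib_right sum_divide_distrib by (intro sum.cong) auto
    finally show "\<bar>poly q s - poly q t\<bar> \<le> K * M / \<Delta> * \<bar>s - t\<bar>" .
  qed
qed

section \<open>Taylor polynomials at the left endpoint\<close>

text \<open>Taylor's theorem on the convex set \<open>{c..d}\<close> needs only derivatives within
  that set, so one-sided derivatives at \<open>c\<close> suffice. The top derivative is continuous
  on a compact interval and therefore bounded.\<close>

lemma Ck_on_taylor_poly:
  assumes "Ck_on (Suc n) f {c..d}" "c \<le> d"
  obtains T M where "degree T \<le> n" "M \<ge> 0"
    "\<And>x. x \<in> {c..d} \<Longrightarrow> \<bar>f x - poly T x\<bar> \<le> M * (x - c) ^ Suc n"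
proof -
  obtain D where D0: "\<And>x. x \<in> {c..d} \<Longrightarrow> D 0 x = f x"
    and D: "\<And>j x. j < Suc n \<Longrightarrow> x \<in> {c..d} \<Longrightarrow> (D j has_real_derivative D (Suc j) x) (at x within {c..d})"
    and cont: "continuous_on {c..d} (D (Suc n))"
    using assms(1) unfolding Ck_on_def by blast
  have "bounded (D (Suc n) ` {c..d})"
    by (intro compact_imp_bounded compact_continuous_image cont compact_Icc)
  then obtain B where B: "\<And>x. x \<in> {c..d} \<Longrightarrow> norm (D (Suc n) x) \<le> B"
    unfolding bounded_iff by blast
  define T where "T = (\<Sum>i\<le>n. smult (D i c / fact i) ([:- c, 1:] ^ i))"
  show ?thesis
  proof
    show "degree T \<le> n"
      unfolding T_def
    proof (rule degree_sum_le)
      fix i assume "i \<in> {..n}"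
      then show "degree (smult (D i c / fact i) ([:- c, 1:] ^ i)) \<le> n"
        using degree_smult_le[of "D i c / fact i" "[:- c, 1:] ^ i"] degree_power_le[of "[:- c, 1:]" i]
        by simp
    qed simp
    show "B / fact n \<ge> 0"
      using B[of c] assms(2) by (auto intro: order_trans[OF norm_ge_zero])
    show "\<bar>f x - poly T x\<bar> \<le> B / fact n * (x - c) ^ Suc n" if x: "x \<in> {c..d}" for x
    proof -
      have "norm (D 0 x - (\<Sum>i\<le>n. D i c * (x - c) ^ i / fact i)) \<le> B * norm (x - c) ^ Suc n / fact n"
        by (rule field_Taylor[where S="{c..d}"]) (use D B x assms(2) in auto)
      moreover have "poly T x = (\<Sum>i\<le>n. D i c * (x - c) ^ i / fact i)"
        unfolding T_def by (simp add: poly_sum)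
      ultimately show ?thesis
        using x by (simp add: D0)
    qed
  qed
qed

text \<open>The remainder \<open>f - T\<close> vanishes at \<open>c\<close> and its difference
  quotient there is at most \<open>M * (x - c) ^ n\<close>, which tends to 0. Its one-sided
  derivative is thus 0, and the derivatives of \<open>f\<close> and \<open>T\<close> at
  \<open>c\<close> agree.\<close>

lemma taylor_poly_deriv_eq:
  assumes "c < d" "n > 0"
    and bound: "\<And>x. x \<in> {c..d} \<Longrightarrow> \<bar>f x - poly T x\<bar> \<le> M * (x - c) ^ Suc n"
    and deriv: "(f has_real_derivative C) (at c within {c..d})"
  shows "poly (pderiv T) c = C"
proof -
  let ?u = "\<lambda>x. f x - poly T x"
  have "?u c = 0"
    using bound[of c] assms(1) by simp
  have "((\<lambda>x. M * (x - c) ^ n) \<longlongrightarrow> M * (c - c) ^ n) (at c within {c..d})"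
    by (intro tendsto_intros)
  then have lim0: "((\<lambda>x. M * (x - c) ^ n) \<longlongrightarrow> 0) (at c within {c..d})"
    using assms(2) by (simp add: power_0_left)
  have "((\<lambda>x. (?u x - ?u c) / (x - c)) \<longlongrightarrow> 0) (at c within {c..d})"
  proof (rule Lim_null_comparison[OF _ lim0])
    show "\<forall>\<^sub>F x in at c within {c..d}. norm ((?u x - ?u c) / (x - c)) \<le> M * (x - c) ^ n"
      unfolding eventually_at_filter
    proof (intro always_eventually allI impI)
      fix x assume "x \<noteq> c" "x \<in> {c..d}"
      then show "norm ((?u x - ?u c) / (x - c)) \<le> M * (x - c) ^ n"
        using bound[of x] \<open>?u c = 0\<close> by (simp add: divide_le_eq mult_ac)
    qed
  qed
  moreover have "(?u has_real_derivative C - poly (pderiv T) c) (at c within {c..d})"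
    by (intro DERIV_diff deriv has_field_derivative_at_within[OF poly_DERIV])
  then have "((\<lambda>x. (?u x - ?u c) / (x - c)) \<longlongrightarrow> C - poly (pderiv T) c) (at c within {c..d})"
    unfolding has_field_derivative_iff .
  moreover have "at c within {c..d} \<noteq> bot"
    using assms(1) by (simp add: trivial_limit_within islimpt_Icc)
  ultimately have "C - poly (pderiv T) c = 0"
    by (intro tendsto_unique)
  then show ?thesis by simp
qed

section \<open>Lower slope bounds and localisation of the nearest root\<close>

text \<open>By continuity the derivative stays above \<open>m\<close> near \<open>c\<close>; the
  mean value theorem turns this into a bound on increments.\<close>

lemma poly_increment_ge:
  fixes p :: "real poly"
  assumes "m < poly (pderiv p) c"
  obtains \<delta> where "\<delta> > 0"
    "\<And>s t. \<lbrakk>\<bar>s - c\<bar> < \<delta>; \<bar>t - c\<bar> < \<delta>; s \<le> t\<rbrakk> \<Longrightarrow> m * (t - s) \<le> poly p t - poly p s"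
proof -
  have "\<forall>\<^sub>F x in nhds c. m < poly (pderiv p) x"
    using assms by (intro order_tendstoD(1)[OF poly_isCont[unfolded isCont_def tendsto_at_iff_tendsto_nhds]])
  then obtain \<delta> where \<delta>: "\<delta> > 0" "\<And>x. \<bar>x - c\<bar> < \<delta> \<Longrightarrow> m < poly (pderiv p) x"
    unfolding eventually_nhds_metric dist_real_def by blast
  show ?thesis
  proof
    show "m * (t - s) \<le> poly p t - poly p s" if "\<bar>s - c\<bar> < \<delta>" "\<bar>t - c\<bar> < \<delta>" "s \<le> t" for s t
    proof (cases "s = t")
      case False
      then obtain z where z: "s < z" "z < t" "poly p t - poly p s = (t - s) * poly (pderiv p) z"
        using poly_MVT[of s t p] \<open>s \<le> t\<close> by force
      then have "m < poly (pderiv p) z"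
        using that by (intro \<delta>(2)) linarith
      then show ?thesis
        using z False that(3) by (simp add: mult.commute mult_left_mono)
    qed simp
  qed (rule \<delta>(1))
qed

text \<open>The slope bound makes \<open>p\<close> strictly increasing on the window of radius
  \<open>2 * \<Delta>\<close> about \<open>x\<close>, so it has at most one root there. A sign
  change within \<open>\<bar>poly p c\<bar> / m\<close> of \<open>c\<close> supplies one, and any
  root outside the window is farther from \<open>x\<close>, so the \<open>ARG_MIN\<close> selects
  exactly this root.\<close>

lemma nearest_root_close:
  fixes p :: "real poly"
  assumes "m > 0" and slope: "\<And>s t. \<lbrakk>\<bar>s - x\<bar> \<le> 2 * \<Delta>; \<bar>t - x\<bar> \<le> 2 * \<Delta>; s \<le> t\<rbrakk>
      \<Longrightarrow> m * (t - s) \<le> poly p t - poly p s"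
    and c: "\<bar>c - x\<bar> \<le> \<Delta>" and small: "\<bar>poly p c\<bar> \<le> m * \<Delta>"
  defines "r \<equiv> (ARG_MIN (\<lambda>t. \<bar>t - x\<bar>) t. poly p t = 0)"
  shows "\<bar>r - c\<bar> \<le> \<bar>poly p c\<bar> / m" and "\<bar>r - x\<bar> \<le> 2 * \<Delta>"
proof -
  define \<epsilon> where "\<epsilon> = \<bar>poly p c\<bar> / m"
  have \<epsilon>: "0 \<le> \<epsilon>" "\<epsilon> \<le> \<Delta>" "m * \<epsilon> = \<bar>poly p c\<bar>"
    using assms(1) small by (auto simp: \<epsilon>_def field_simps)
  have near: "\<bar>s - c\<bar> \<le> \<epsilon>" if "\<bar>s - x\<bar> \<le> 2 * \<Delta>" "poly p s = 0" for s
  proof -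
    have "m * \<bar>s - c\<bar> \<le> \<bar>poly p c\<bar>"
      using slope[of s c] slope[of c s] that c \<epsilon> by (cases "s \<le> c") (auto simp: abs_if)
    then show ?thesis
      using assms(1) by (simp add: \<epsilon>_def field_simps)
  qed
  \<comment> \<open>Moving by \<epsilon> changes \<open>p\<close> by at least
    \<open>m * \<epsilon> = \<bar>poly p c\<bar>\<close>, enough to reach either sign. Both points
    are in the window because \<open>\<bar>c - x\<bar> \<le> \<Delta>\<close> and
    \<open>\<epsilon> \<le> \<Delta>\<close>.\<close>
  have "poly p (c - \<epsilon>) \<le> 0" "0 \<le> poly p (c + \<epsilon>)"
    using slope[of "c - \<epsilon>" c] slope[of c "c + \<epsilon>"] c \<epsilon> by (simp_all add: abs_le_iff)
  then obtain z where z: "c - \<epsilon> \<le> z" "z \<le> c + \<epsilon>" "poly p z = 0"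
    using IVT'[of "poly p" "c - \<epsilon>" 0 "c + \<epsilon>"] \<epsilon>(1) continuous_on_poly[OF continuous_on_id]
    by auto
  have zx: "\<bar>z - x\<bar> \<le> 2 * \<Delta>"
    using z c \<epsilon> by linarith
  have uniq: "s = z" if "\<bar>s - x\<bar> \<le> 2 * \<Delta>" "poly p s = 0" for s
  proof (rule ccontr)
    assume "s \<noteq> z"
    then have "m * \<bar>s - z\<bar> > 0"
      using assms(1) by simp
    moreover have "m * \<bar>s - z\<bar> \<le> 0"
      using slope[of s z] slope[of z s] that zx z by (cases "s \<le> z") (auto simp: abs_if)
    ultimately show False by linarith
  qed
  have "poly p r = 0 \<and> \<bar>r - x\<bar> \<le> \<bar>z - x\<bar>"
    unfolding r_def
  proof (rule arg_minI[where x=z])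
    show "\<not> \<bar>y - x\<bar> < \<bar>z - x\<bar>" if "poly p y = 0" for y
      using uniq[of y] that zx by linarith
  qed (use z in auto)
  then show "\<bar>r - x\<bar> \<le> 2 * \<Delta>" "\<bar>r - c\<bar> \<le> \<bar>poly p c\<bar> / m"
    using near[of r] zx by (auto simp: \<epsilon>_def)
qed

section \<open>The sampling grid and its first node in the hole\<close>

lemma step_pos: "a < b \<Longrightarrow> N > 0 \<Longrightarrow> step a b N > 0"
  by (simp add: step_def)

lemma step_tendsto_0: "step a b \<longlonglongrightarrow> 0"
proof -
  have "(\<lambda>N. (b - a) / real N) \<longlonglongrightarrow> 0"
    by (rule lim_const_over_n)
  then show ?thesis
    by (simp add: step_def[abs_def])
qed

lemma grid_add: "grid a b N (n + i) = grid a b N n + real i * step a b N"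
  by (simp add: grid_def algebra_simps)

text \<open>The first index is one more than the integer part of
  \<open>(c - a) / step a b N\<close>. That node exceeds \<open>c\<close> by at most one step, and a
  step shorter than \<open>d - c\<close> keeps it left of \<open>d\<close>.\<close>

lemma grid_first_index:
  assumes "a \<le> c" "d \<le> b" "N > 0" "0 < step a b N" "step a b N < d - c"
  shows "c < grid a b N (first_index a b c d N)"
    and "grid a b N (first_index a b c d N) \<le> c + step a b N"
proof -
  let ?\<Delta> = "step a b N"
  define k where "k = nat \<lfloor>(c - a) / ?\<Delta>\<rfloor>"
  have "real k = of_int \<lfloor>(c - a) / ?\<Delta>\<rfloor>"
    using assms by (simp add: k_def)
  \<comment> \<open>Node \<open>k\<close> is the last one not beyond \<open>c\<close>. The second
    inequality is strict, so node \<open>Suc k\<close> lies strictly to the right even if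
    \<open>c\<close> is itself a node.\<close>
  then have "real k \<le> (c - a) / ?\<Delta>" "(c - a) / ?\<Delta> < real k + 1"
    by linarith+
  then have k: "real k * ?\<Delta> \<le> c - a" "c - a < (real k + 1) * ?\<Delta>"
    using assms(4) by (simp_all add: field_simps)
  then have lower: "c < grid a b N (Suc k)" and upper: "grid a b N (Suc k) \<le> c + ?\<Delta>"
    by (auto simp: grid_def algebra_simps)
  have mono: "grid a b N i \<le> grid a b N j \<longleftrightarrow> i \<le> j" for i j
    using assms(4) by (simp add: grid_def)
  have "grid a b N N = b"
    using assms(3) by (simp add: grid_def step_def)
  then have "grid a b N (Suc k) \<le> grid a b N N"
    using upper assms by linarith
  then have "Suc k \<le> N"
    by (simp only: mono)
  have "first_index a b c d N = Suc k"
    unfolding first_index_def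
  proof (rule Least_equality)
    show "Suc k \<le> N \<and> grid a b N (Suc k) \<in> {c<..<d}"
      using \<open>Suc k \<le> N\<close> lower upper assms(5) by auto
    show "Suc k \<le> i" if "i \<le> N \<and> grid a b N i \<in> {c<..<d}" for i
    proof (rule ccontr)
      assume "\<not> Suc k \<le> i"
      then have "grid a b N i \<le> grid a b N k"
        by (simp add: mono)
      also have "\<dots> \<le> c"
        using k by (simp add: grid_def)
      finally show False
        using that by simp
    qed
  qed
  with lower upper show "c < grid a b N (first_index a b c d N)"
    "grid a b N (first_index a b c d N) \<le> c + ?\<Delta>"
    by auto
qed

section \<open>The cubic interpolants at the left end\<close>

text \<open>Existence and uniqueness of the interpolating cubic show that the \<open>THE\<close> in
  \<open>left_cubic\<close> is a genuine description.\<close>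

lemma left_cubic_interpolates:
  fixes a b c d :: real and f :: "real \<Rightarrow> real" and N :: nat
  assumes "step a b N > 0"
  defines "p \<equiv> left_cubic a b c d f N" and "x \<equiv> grid a b N (first_index a b c d N)"
  shows "degree p \<le> 3"
    and "i \<le> 3 \<Longrightarrow> poly p (x + real i * step a b N) = f (x + real i * step a b N)"
proof -
  let ?\<Delta> = "step a b N" and ?n = "first_index a b c d N"
  let ?Q = "\<lambda>p. degree p \<le> 3 \<and> (\<forall>i\<in>{?n..?n+3}. poly p (grid a b N i) = f (grid a b N i))"
  have Q: "?Q p \<longleftrightarrow> degree p \<le> 3 \<and> (\<forall>i\<le>3. poly p (x + real i * ?\<Delta>) = f (x + real i * ?\<Delta>))" for p
  proof -
    have "{?n..?n+3} = (\<lambda>i. ?n + i) ` {..3}"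
      by (simp add: atMost_atLeast0)
    then show ?thesis
      unfolding x_def by (auto simp: grid_add)
  qed
  obtain p0 where "degree p0 \<le> 3" "\<And>i. i \<le> 3 \<Longrightarrow> poly p0 (x + real i * ?\<Delta>) = f (x + real i * ?\<Delta>)"
    using interpolating_poly_exists[of ?\<Delta> 3 x "\<lambda>i. f (x + real i * ?\<Delta>)"] assms(1) by auto
  then have "\<exists>p. ?Q p"
    unfolding Q by blast
  moreover have "p1 = p2" if "?Q p1" "?Q p2" for p1 p2
    by (rule poly_eqI_nodes[where n=3 and \<Delta>="?\<Delta>" and x=x]) (use that[unfolded Q] assms(1) in auto)
  ultimately have "\<exists>!p. ?Q p"
    by blast
  then have "?Q p"
    unfolding p_def left_cubic_def Let_def by (rule theI')
  then show "degree p \<le> 3"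
    "i \<le> 3 \<Longrightarrow> poly p (x + real i * ?\<Delta>) = f (x + real i * ?\<Delta>)"
    unfolding Q by auto
qed

text \<open>The difference of interpolant and \<open>T\<close> is a cubic whose nodal values are
  Taylor remainders, of size \<open>M * (4 * \<Delta>) ^ 4\<close>. Stability with
  \<open>n = 3\<close> and \<open>r = 2\<close> spreads this bound over the window, with constants
  independent of \<open>N\<close>.\<close>

lemma left_cubic_near_taylor_poly:
  fixes f :: "real \<Rightarrow> real"
  assumes "a \<le> c" "d \<le> b" "degree T \<le> 3" "M \<ge> 0"
    and bound: "\<And>x. x \<in> {c..d} \<Longrightarrow> \<bar>f x - poly T x\<bar> \<le> M * (x - c) ^ 4"
  obtains K where "K \<ge> 0"
    "\<And>N s. \<lbrakk>N > 0; 0 < step a b N; 4 * step a b N < d - c;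
       \<bar>s - grid a b N (first_index a b c d N)\<bar> \<le> 2 * step a b N\<rbrakk>
       \<Longrightarrow> \<bar>poly (left_cubic a b c d f N - T) s\<bar> \<le> K * step a b N ^ 4"
    "\<And>N s t. \<lbrakk>N > 0; 0 < step a b N; 4 * step a b N < d - c;
       \<bar>s - grid a b N (first_index a b c d N)\<bar> \<le> 2 * step a b N;
       \<bar>t - grid a b N (first_index a b c d N)\<bar> \<le> 2 * step a b N\<rbrakk>
       \<Longrightarrow> \<bar>poly (left_cubic a b c d f N - T) s - poly (left_cubic a b c d f N - T) t\<bar>
           \<le> K * step a b N ^ 3 * \<bar>s - t\<bar>"
proof -
  obtain K where "K \<ge> 0"
    and K1: "\<And>(q :: real poly) x \<Delta> M s. \<lbrakk>degree q \<le> 3; \<Delta> > 0;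
       \<And>i. i \<le> 3 \<Longrightarrow> \<bar>poly q (x + real i * \<Delta>)\<bar> \<le> M; \<bar>s - x\<bar> \<le> 2 * \<Delta>\<rbrakk> \<Longrightarrow> \<bar>poly q s\<bar> \<le> K * M"
    and K2: "\<And>(q :: real poly) x \<Delta> M s t. \<lbrakk>degree q \<le> 3; \<Delta> > 0;
       \<And>i. i \<le> 3 \<Longrightarrow> \<bar>poly q (x + real i * \<Delta>)\<bar> \<le> M; \<bar>s - x\<bar> \<le> 2 * \<Delta>; \<bar>t - x\<bar> \<le> 2 * \<Delta>\<rbrakk>
       \<Longrightarrow> \<bar>poly q s - poly q t\<bar> \<le> K * M / \<Delta> * \<bar>s - t\<bar>"
    by (rule equispaced_interpolation_stable[of 3 2], erule that) blast+
  have deg: "degree (left_cubic a b c d f N - T) \<le> 3" if "0 < step a b N" for N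
    by (intro degree_diff_le left_cubic_interpolates(1)[OF that] assms(3))
  have nodes: "\<bar>poly (left_cubic a b c d f N - T) (grid a b N (first_index a b c d N) + real i * step a b N)\<bar>
      \<le> M * (4 * step a b N) ^ 4"
    if "N > 0" "0 < step a b N" "4 * step a b N < d - c" "i \<le> 3" for N i
  proof -
    let ?x = "grid a b N (first_index a b c d N)" and ?\<Delta> = "step a b N"
    let ?y = "?x + real i * ?\<Delta>"
    have x: "c < ?x" "?x \<le> c + ?\<Delta>"
      using grid_first_index[of a c d b N] assms(1,2) that by auto
    have "0 \<le> real i * ?\<Delta>" "real i * ?\<Delta> \<le> 3 * ?\<Delta>"
      using that by (auto intro: mult_right_mono)
    \<comment> \<open>One step at most from \<open>c\<close> to the first node and three more to the
      last. As \<open>4 * \<Delta> < d - c\<close>, all four nodes lie in \<open>{c..d}\<close>,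
      where the Taylor bound holds.\<close>
    with x have y: "0 \<le> ?y - c" "?y - c \<le> 4 * ?\<Delta>"
      by linarith+
    have "poly (left_cubic a b c d f N - T) ?y = f ?y - poly T ?y"
      using left_cubic_interpolates(2)[OF that(2,4)] by simp
    then have "\<bar>poly (left_cubic a b c d f N - T) ?y\<bar> \<le> M * (?y - c) ^ 4"
      using bound[of ?y] y that(3) by simp
    also have "\<dots> \<le> M * (4 * ?\<Delta>) ^ 4"
      by (intro mult_left_mono power_mono y assms(4))
    finally show ?thesis .
  qed
  show ?thesis
  proof
    \<comment> \<open>The factor 256 is \<open>4 ^ 4\<close>.\<close>
    show "K * M * 256 \<ge> 0"
      using \<open>K \<ge> 0\<close> assms(4) by simp
  next
    fix N s assume N: "N > 0" "0 < step a b N" "4 * step a b N < d - c"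
      and s: "\<bar>s - grid a b N (first_index a b c d N)\<bar> \<le> 2 * step a b N"
    show "\<bar>poly (left_cubic a b c d f N - T) s\<bar> \<le> K * M * 256 * step a b N ^ 4"
      using K1[OF deg[OF N(2)] N(2) nodes[OF N] s] by (simp add: power_mult_distrib mult_ac)
  next
    fix N s t assume N: "N > 0" "0 < step a b N" "4 * step a b N < d - c"
      and s: "\<bar>s - grid a b N (first_index a b c d N)\<bar> \<le> 2 * step a b N"
      and t: "\<bar>t - grid a b N (first_index a b c d N)\<bar> \<le> 2 * step a b N"
    have "K * (M * (4 * step a b N) ^ 4) / step a b N = K * M * 256 * step a b N ^ 3"
      using N(2) by (simp add: power_mult_distrib eval_nat_numeral)
    then show "\<bar>poly (left_cubic a b c d f N - T) s - poly (left_cubic a b c d f N - T) t\<bar>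
        \<le> K * M * 256 * step a b N ^ 3 * \<bar>s - t\<bar>"
      using K2[OF deg[OF N(2)] N(2) nodes[OF N] s t] by simp
  qed
qed

section \<open>The error estimate\<close>

theorem proposition4p1:
  fixes a b c d C :: real and g h :: "real \<Rightarrow> real"
  assumes "hole_boundaries a b c d g h"
    and "Ck_on 4 g {c..d}" and "Ck_on 4 h {c..d}"
    and "((\<lambda>x. h x - g x) has_real_derivative C) (at c within {c..d})"
    and "C > 0"
  shows "(\<lambda>N. left_pct_error a b c d g h N) \<in> O[sequentially](\<lambda>N. (step a b N) ^ 4)"
proof -
  have abcd: "a < c" "c < d" "d < b" "a < b" "a \<le> c" "d \<le> b" and gh: "g c = h c"
    using assms(1) by (auto simp: hole_boundaries_def)
  obtain Tg Mg where Tg: "degree Tg \<le> 3" "Mg \<ge> 0"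
    "\<And>x. x \<in> {c..d} \<Longrightarrow> \<bar>g x - poly Tg x\<bar> \<le> Mg * (x - c) ^ 4"
    using Ck_on_taylor_poly[of 3 g c d] assms(2) abcd by auto
  obtain Th Mh where Th: "degree Th \<le> 3" "Mh \<ge> 0"
    "\<And>x. x \<in> {c..d} \<Longrightarrow> \<bar>h x - poly Th x\<bar> \<le> Mh * (x - c) ^ 4"
    using Ck_on_taylor_poly[of 3 h c d] assms(3) abcd by auto
  \<comment> \<open>At \<open>x = c\<close> the remainder bounds are 0.\<close>
  have Tc: "poly Tg c = g c" "poly Th c = h c"
    using Tg(3)[of c] Th(3)[of c] abcd by auto
  have "\<bar>(h x - g x) - poly (Th - Tg) x\<bar> \<le> (Mg + Mh) * (x - c) ^ Suc 3" if "x \<in> {c..d}" for x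
  proof -
    have "\<bar>(h x - g x) - poly (Th - Tg) x\<bar> \<le> \<bar>g x - poly Tg x\<bar> + \<bar>h x - poly Th x\<bar>"
      by simp
    then show ?thesis
      using Tg(3)[OF that] Th(3)[OF that] by (simp add: distrib_right)
  qed
  then have "poly (pderiv (Th - Tg)) c = C"
    using abcd assms(4) by (intro taylor_poly_deriv_eq[where n=3]) auto
  \<comment> \<open>Slope \<open>3 * C / 4\<close> for the Taylor part leaves \<open>C / 4\<close>
    to be lost to the interpolation errors, so that \<open>C / 2\<close> remains.\<close>
  then obtain \<delta> where \<delta>: "\<delta> > 0"
    "\<And>s t. \<lbrakk>\<bar>s - c\<bar> < \<delta>; \<bar>t - c\<bar> < \<delta>; s \<le> t\<rbrakk> \<Longrightarrow> 3 * C / 4 * (t - s) \<le> poly (Th - Tg) t - poly (Th - Tg) s"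
    using poly_increment_ge[of "3 * C / 4" "Th - Tg" c] assms(5) by auto
  \<comment> \<open>A fixed neighbourhood of \<open>c\<close> is enough: the approximate abscissa
    will be within \<open>3 * \<Delta> < 1\<close> of \<open>c\<close>.\<close>
  obtain L where L: "L \<ge> 0"
    "\<And>s. s \<in> {c-1..c+1} \<Longrightarrow> \<bar>poly Tg s\<bar> \<le> L"
    "\<And>s t. s \<in> {c-1..c+1} \<Longrightarrow> t \<in> {c-1..c+1} \<Longrightarrow> \<bar>poly Tg s - poly Tg t\<bar> \<le> L * \<bar>s - t\<bar>"
    by (rule poly_bounded_lipschitz_on_Icc[of "c - 1" "c + 1" Tg], erule that) blast+

  let ?\<Delta> = "step a b"
  let ?x = "\<lambda>N. grid a b N (first_index a b c d N)"
  let ?eg = "\<lambda>N. left_cubic a b c d g N - Tg" and ?eh = "\<lambda>N. left_cubic a b c d h N - Th"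
  obtain Kg where Kg: "Kg \<ge> 0"
    "\<And>N s. \<lbrakk>N > 0; 0 < ?\<Delta> N; 4 * ?\<Delta> N < d - c; \<bar>s - ?x N\<bar> \<le> 2 * ?\<Delta> N\<rbrakk>
       \<Longrightarrow> \<bar>poly (?eg N) s\<bar> \<le> Kg * ?\<Delta> N ^ 4"
    "\<And>N s t. \<lbrakk>N > 0; 0 < ?\<Delta> N; 4 * ?\<Delta> N < d - c; \<bar>s - ?x N\<bar> \<le> 2 * ?\<Delta> N; \<bar>t - ?x N\<bar> \<le> 2 * ?\<Delta> N\<rbrakk>
       \<Longrightarrow> \<bar>poly (?eg N) s - poly (?eg N) t\<bar> \<le> Kg * ?\<Delta> N ^ 3 * \<bar>s - t\<bar>"
    by (rule left_cubic_near_taylor_poly[of a c d b Tg Mg g, OF abcd(5,6) Tg(1,2)], erule Tg(3), erule that) blast+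
  obtain Kh where Kh: "Kh \<ge> 0"
    "\<And>N s. \<lbrakk>N > 0; 0 < ?\<Delta> N; 4 * ?\<Delta> N < d - c; \<bar>s - ?x N\<bar> \<le> 2 * ?\<Delta> N\<rbrakk>
       \<Longrightarrow> \<bar>poly (?eh N) s\<bar> \<le> Kh * ?\<Delta> N ^ 4"
    "\<And>N s t. \<lbrakk>N > 0; 0 < ?\<Delta> N; 4 * ?\<Delta> N < d - c; \<bar>s - ?x N\<bar> \<le> 2 * ?\<Delta> N; \<bar>t - ?x N\<bar> \<le> 2 * ?\<Delta> N\<rbrakk>
       \<Longrightarrow> \<bar>poly (?eh N) s - poly (?eh N) t\<bar> \<le> Kh * ?\<Delta> N ^ 3 * \<bar>s - t\<bar>"
    by (rule left_cubic_near_taylor_poly[of a c d b Th Mh h, OF abcd(5,6) Th(1,2)], erule Th(3), erule that) blast+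
  define K where "K = Kg + Kh"
  have "K \<ge> 0"
    using Kg(1) Kh(1) by (simp add: K_def)

  \<comment> \<open>The root error is at most the value \<open>K * \<Delta> ^ 4\<close> at
    \<open>c\<close> divided by the slope \<open>C / 2\<close>.\<close>
  define B where "B = 2 * K / C"
  have "B \<ge> 0"
    using \<open>K \<ge> 0\<close> assms(5) by (simp add: B_def)
  \<comment> \<open>The first summand bounds the abscissa error, the second the ordinate error, both
    in units of \<open>\<Delta> ^ 4\<close>.\<close>
  define A where "A = B + (Kg + (L + Kg) * B)"
  have main: "norm (left_pct_error a b c d g h N) \<le> A * norm (?\<Delta> N ^ 4)"
    if N: "N > 0" "0 < ?\<Delta> N" "4 * ?\<Delta> N < d - c"
      and small: "4 * ?\<Delta> N < \<delta>" "4 * ?\<Delta> N < 1" "K * ?\<Delta> N ^ 3 < C / 4" for N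
  proof -
    define \<Delta> x where "\<Delta> = ?\<Delta> N" and "x = ?x N"
    have x: "c < x" "x \<le> c + \<Delta>"
      using grid_first_index[of a c d b N] abcd N by (auto simp: x_def \<Delta>_def)
    have \<Delta>: "0 < \<Delta>" "4 * \<Delta> < \<delta>" "4 * \<Delta> < 1" "K * \<Delta> ^ 3 < C / 4"
      using N small by (simp_all add: \<Delta>_def)
    note eg = Kg(2,3)[OF N, folded \<Delta>_def x_def] and eh = Kh(2,3)[OF N, folded \<Delta>_def x_def]
    have cx: "\<bar>c - x\<bar> \<le> \<Delta>" "\<bar>c - x\<bar> \<le> 2 * \<Delta>"
      using x by linarith+
    define p where "p = left_cubic a b c d h N - left_cubic a b c d g N"
    have p: "poly p s = poly (Th - Tg) s + (poly (?eh N) s - poly (?eg N) s)" for s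
      by (simp add: p_def)
    have slope: "C / 2 * (t - s) \<le> poly p t - poly p s"
      if st: "\<bar>s - x\<bar> \<le> 2 * \<Delta>" "\<bar>t - x\<bar> \<le> 2 * \<Delta>" "s \<le> t" for s t
    proof -
      have "3 * C / 4 * (t - s) \<le> poly (Th - Tg) t - poly (Th - Tg) s"
        using st x \<Delta> by (intro \<delta>(2)) linarith+
      moreover have "\<bar>poly (?eg N) t - poly (?eg N) s\<bar> + \<bar>poly (?eh N) t - poly (?eh N) s\<bar>
          \<le> K * \<Delta> ^ 3 * (t - s)"
        using eg(2)[OF st(2,1)] eh(2)[OF st(2,1)] st(3) by (simp add: K_def algebra_simps)
      moreover have "K * \<Delta> ^ 3 * (t - s) \<le> C / 4 * (t - s)"
        using \<Delta>(4) st(3) by (intro mult_right_mono) auto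
      moreover have "3 * C / 4 * (t - s) = C / 2 * (t - s) + C / 4 * (t - s)"
        by (simp add: field_simps)
      ultimately show ?thesis
        unfolding p by linarith
    qed
    \<comment> \<open>Since \<open>g c = h c\<close>, the Taylor polynomials cancel at
      \<open>c\<close> and only the two interpolation errors remain.\<close>
    have pc: "\<bar>poly p c\<bar> \<le> K * \<Delta> ^ 4"
      using eg(1)[OF cx(2)] eh(1)[OF cx(2)] by (simp add: p Tc gh K_def algebra_simps)
    have "K * \<Delta> ^ 4 = K * \<Delta> ^ 3 * \<Delta>"
      by (simp add: eval_nat_numeral)
    also have "\<dots> \<le> C / 2 * \<Delta>"
      using \<Delta> assms(5) by (intro mult_right_mono) auto
    finally have pc': "\<bar>poly p c\<bar> \<le> C / 2 * \<Delta>"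
      using pc by linarith
    define r where "r = left_root a b c d g h N"
    have r_eq: "r = (ARG_MIN (\<lambda>t. \<bar>t - x\<bar>) t. poly p t = 0)"
      by (simp add: r_def left_root_def p_def x_def)
    have r: "\<bar>r - c\<bar> \<le> \<bar>poly p c\<bar> / (C / 2)" "\<bar>r - x\<bar> \<le> 2 * \<Delta>"
      using nearest_root_close[of "C / 2" x \<Delta> p c, OF _ slope cx(1) pc'] assms(5)
      unfolding r_eq by auto
    define z where "z = left_pct_abscissa a b c d g h N"
    have z_eq: "z = (if r < x - \<Delta> then x - \<Delta> else r)"
      by (simp add: z_def left_pct_abscissa_def Let_def r_def x_def \<Delta>_def)
    have zx: "\<bar>z - x\<bar> \<le> 2 * \<Delta>"
      using r(2) \<Delta>(1) by (auto simp: z_eq)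
    \<comment> \<open>Truncation can only help: \<open>x - \<Delta> \<le> c\<close>, so replacing a
      root left of \<open>x - \<Delta>\<close> by \<open>x - \<Delta>\<close> moves it towards
      \<open>c\<close>.\<close>
    have "\<bar>c - z\<bar> \<le> \<bar>r - c\<bar>"
      using cx(1) by (auto simp: z_eq)
    also have "\<dots> \<le> \<bar>poly p c\<bar> / (C / 2)"
      by (rule r(1))
    also have "\<dots> \<le> K * \<Delta> ^ 4 / (C / 2)"
      using pc assms(5) by (intro divide_right_mono) auto
    also have "\<dots> = B * \<Delta> ^ 4"
      by (simp add: B_def)
    finally have cz: "\<bar>c - z\<bar> \<le> B * \<Delta> ^ 4" .
    define q where "q = left_cubic a b c d g N"
    \<comment> \<open>Here \<open>g c = poly Tg c\<close>, and \<open>q\<close> is \<open>Tg\<close>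
      plus its interpolation error. The error at \<open>z\<close> is split into its value at
      \<open>c\<close>, of order \<open>\<Delta> ^ 4\<close>, and an increment controlled by
      \<open>\<bar>c - z\<bar>\<close>.\<close>
    have "\<bar>g c - poly q z\<bar> \<le> \<bar>poly (?eg N) c\<bar> + \<bar>poly Tg c - poly Tg z\<bar> + \<bar>poly (?eg N) c - poly (?eg N) z\<bar>"
      using Tc by (simp add: q_def)
    also have "\<dots> \<le> Kg * \<Delta> ^ 4 + L * \<bar>c - z\<bar> + Kg * \<bar>c - z\<bar>"
    proof (intro add_mono)
      show "\<bar>poly (?eg N) c\<bar> \<le> Kg * \<Delta> ^ 4"
        by (rule eg(1)[OF cx(2)])
      show "\<bar>poly Tg c - poly Tg z\<bar> \<le> L * \<bar>c - z\<bar>"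
        using zx x \<Delta> by (intro L(3)) (auto simp: abs_le_iff)
      have "\<Delta> ^ 3 \<le> 1"
        using \<Delta> by (intro power_le_one) auto
      then have "Kg * \<Delta> ^ 3 * \<bar>c - z\<bar> \<le> Kg * 1 * \<bar>c - z\<bar>"
        using Kg(1) by (intro mult_right_mono mult_left_mono) auto
      then show "\<bar>poly (?eg N) c - poly (?eg N) z\<bar> \<le> Kg * \<bar>c - z\<bar>"
        using eg(2)[OF cx(2) zx] by linarith
    qed
    also have "\<dots> = Kg * \<Delta> ^ 4 + (L + Kg) * \<bar>c - z\<bar>"
      by (simp add: algebra_simps)
    also have "\<dots> \<le> Kg * \<Delta> ^ 4 + (L + Kg) * (B * \<Delta> ^ 4)"
      using cz L(1) Kg(1) by (intro add_left_mono mult_left_mono) auto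
    also have "\<dots> = (Kg + (L + Kg) * B) * \<Delta> ^ 4"
      by (simp add: algebra_simps)
    finally have gz: "\<bar>g c - poly q z\<bar> \<le> (Kg + (L + Kg) * B) * \<Delta> ^ 4" .
    have "left_pct_error a b c d g h N = sqrt (\<bar>c - z\<bar>\<^sup>2 + \<bar>g c - poly q z\<bar>\<^sup>2)"
      by (simp add: left_pct_error_def Let_def z_def q_def)
    also have "\<dots> \<le> \<bar>c - z\<bar> + \<bar>g c - poly q z\<bar>"
      by (rule sqrt_sum_squares_le_sum) auto
    also have "\<dots> \<le> A * \<Delta> ^ 4"
      using cz gz by (simp add: A_def distrib_right)
    finally have "left_pct_error a b c d g h N \<le> A * \<Delta> ^ 4" .
    moreover have "left_pct_error a b c d g h N \<ge> 0"
      by (simp add: left_pct_error_def Let_def)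
    ultimately show ?thesis
      using \<Delta>(1) by (simp add: \<Delta>_def)
  qed

  \<comment> \<open>Every smallness condition of \<open>main\<close> bounds a null sequence by a
    positive constant, so all of them hold eventually.\<close>
  have lim: "(\<lambda>N. 4 * ?\<Delta> N) \<longlonglongrightarrow> 0" "(\<lambda>N. K * ?\<Delta> N ^ 3) \<longlonglongrightarrow> 0"
    using step_tendsto_0[of a b] by (auto intro!: tendsto_eq_intros)
  have small: "\<forall>\<^sub>F N in sequentially. 4 * ?\<Delta> N < d - c" "\<forall>\<^sub>F N in sequentially. 4 * ?\<Delta> N < \<delta>"
    "\<forall>\<^sub>F N in sequentially. 4 * ?\<Delta> N < 1" "\<forall>\<^sub>F N in sequentially. K * ?\<Delta> N ^ 3 < C / 4"
    using \<delta>(1) abcd(2) assms(5)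
    by (intro order_tendstoD(2)[OF lim(1)] order_tendstoD(2)[OF lim(2)]; simp)+
  have "\<forall>\<^sub>F N in sequentially. norm (left_pct_error a b c d g h N) \<le> A * norm (?\<Delta> N ^ 4)"
    using eventually_gt_at_top[of 0] small
  proof eventually_elim
    case (elim N)
    then show ?case
      using main[of N] step_pos[OF abcd(4), of N] by auto
  qed
  then show ?thesis
    by (rule bigoI)
qed

end
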